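(* Let $A$ be a complex commutative semi-simple regular Banach algebra, let $\sigma : A \rightarrow A$ be an automorphism, and let $\widetilde{\sigma} : \Delta(A) \rightarrow \Delta(A)$, $\widetilde{\sigma}(\mu) = \mu \circ \sigma^{-1}$, be the homeomorphism of $\Delta(A)$ (with the Gelfand topology) induced by $\sigma$. Then the non-periodic points of $(\Delta(A), \widetilde{\sigma})$ are dense in $\Delta(A)$ if and only if every non-zero ideal $I \subseteq A \rtimes_{\sigma} \mathbb{Z}$ is such that $I \cap A \neq \{0\}$.
   Context: $\Delta(A)$ denotes the character space of $A$ (the non-zero complex algebra homomorphisms $A \to \mathbb{C}$) with the Gelfand topology, i.e. the weakest topology making all Gelfand transforms $\widehat{a}$, $\widehat{a}(\mu) = \mu(a)$, $a \in A$, continuous. A commutative Banach algebra $A$ (not assumed unital) is semi-simple if the Gelfand transform $a \mapsto \widehat{a}$ is injective; it is regular if for every closed $F \subseteq \Delta(A)$ and every $\phi_0 \in \Delta(A) \setminus F$ there is $a \in A$ with $\widehat{a}(\phi) = 0$ for all $\phi \in F$ and $\widehat{a}(\phi_0) \neq 0$. "Automorphism" means algebra automorphism. The crossed product $A \rtimes_{\sigma} \mathbb{Z}$ is the purely algebraic one: the set of functions $f : \mathbb{Z} \to A$ with $f(n) = 0$ for all but finitely many $n$, with pointwise addition and scalar multiplication and multiplication given by twisted convolution $(f*g)(n) = \sum_{k \in \mathbb{Z}} f(k) \cdot \sigma^k(g(n-k))$. Elements are written as finite sums $\sum_{n} f_n \delta^n$ with $f_n = f(n)$. The algebra $A$ is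 identified with the subalgebra $\{a \delta^0 : a \in A\}$ of $A \rtimes_{\sigma} \mathbb{Z}$. Ideals are two-sided. A point $\mu \in \Delta(A)$ is non-periodic if $\widetilde{\sigma}^n(\mu) \neq \mu$ for all non-zero $n \in \mathbb{Z}$. *)

theory Defs
  imports "HOL-Analysis.Analysis"
begin

(* The Banach algebra is not assumed unital (comm_ring has no unit) and may be zero.
   The last axiom makes scaleR the restriction of scaleC to the reals. *)
class comm_complex_banach_algebra = comm_ring + real_normed_algebra + banach +
  fixes scaleC :: "complex \<Rightarrow> 'a \<Rightarrow> 'a"
  assumes scaleC_add_right: "scaleC c (x + y) = scaleC c x + scaleC c y"
    and scaleC_add_left: "scaleC (c + d) x = scaleC c x + scaleC d x"
    and scaleC_scaleC: "scaleC c (scaleC d x) = scaleC (c * d) x"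
    and scaleC_one: "scaleC 1 x = x"
    and mult_scaleC_left: "scaleC c x * y = scaleC c (x * y)"
    and norm_scaleC: "norm (scaleC c x) = cmod c * norm x"
    and scaleR_scaleC: "r *\<^sub>R x = scaleC (complex_of_real r) x"

instantiation complex :: comm_complex_banach_algebra
begin

definition scaleC_complex :: "complex \<Rightarrow> complex \<Rightarrow> complex" where
  "scaleC_complex c z = c * z"

instance
  by standard (auto simp: scaleC_complex_def algebra_simps norm_mult scaleR_conv_of_real)

end

definition complex_algebra_hom ::
    "('a::comm_complex_banach_algebra \<Rightarrow> 'b::comm_complex_banach_algebra) \<Rightarrow> bool" where
  "complex_algebra_hom h \<longleftrightarrow>
     (\<forall>x y. h (x + y) = h x + h y) \<and>
     (\<forall>c x. h (scaleC c x) = scaleC c (h x)) \<and>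
     (\<forall>x y. h (x * y) = h x * h y)"

(* No continuity is imposed on automorphisms or on characters. *)
definition complex_algebra_automorphism :: "('a::comm_complex_banach_algebra \<Rightarrow> 'a) \<Rightarrow> bool" where
  "complex_algebra_automorphism \<sigma> \<longleftrightarrow> complex_algebra_hom \<sigma> \<and> bij \<sigma>"


definition character_space :: "('a::comm_complex_banach_algebra \<Rightarrow> complex) set" where
  "character_space = {\<mu>. complex_algebra_hom \<mu> \<and> (\<exists>x. \<mu> x \<noteq> 0)}"

definition gelfand_transform ::
    "'a::comm_complex_banach_algebra \<Rightarrow> ('a \<Rightarrow> complex) \<Rightarrow> complex" where
  "gelfand_transform a = (\<lambda>\<mu>\<in>character_space. \<mu> a)"

definition gelfand_topology :: "('a::comm_complex_banach_algebra \<Rightarrow> complex) topology" where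
  "gelfand_topology =
     topology_generated_by
       {{\<mu> \<in> character_space. gelfand_transform a \<mu> \<in> U} | a U. open U}"

lemma topspace_gelfand_topology: "topspace gelfand_topology = character_space"
  unfolding gelfand_topology_def topology_generated_by_topspace by blast

lemma continuous_map_gelfand_transform:
  "continuous_map gelfand_topology euclidean (gelfand_transform a)"
  unfolding continuous_map_def topspace_gelfand_topology
  by (auto simp: gelfand_topology_def intro!: topology_generated_by_Basis)

lemma gelfand_topology_weakest:
  assumes "topspace T = character_space"
    and cont: "\<And>a. continuous_map T euclidean (gelfand_transform a)"
    and "openin gelfand_topology V"
  shows "openin T V"
proof -
  have "generate_topology_on
      {{\<mu> \<in> character_space. gelfand_transform a \<mu> \<in> U} | a U. open U} V"
    using assms(3) by (simp add: gelfand_topology_def openin_topology_generated_by_iff)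
  then show ?thesis
  proof induction
    case (Basis s)
    then show ?case
      using openin_continuous_map_preimage[OF cont] assms(1) by auto
  qed auto
qed

definition semisimple_algebra :: "'a::comm_complex_banach_algebra itself \<Rightarrow> bool" where
  "semisimple_algebra _ \<longleftrightarrow> inj (gelfand_transform :: 'a \<Rightarrow> _)"

definition regular_algebra :: "'a::comm_complex_banach_algebra itself \<Rightarrow> bool" where
  "regular_algebra _ \<longleftrightarrow>
     (\<forall>F (\<phi>\<^sub>0 :: 'a \<Rightarrow> complex). closedin gelfand_topology F \<and> \<phi>\<^sub>0 \<in> character_space - F \<longrightarrow>
        (\<exists>a. (\<forall>\<phi>\<in>F. gelfand_transform a \<phi> = 0) \<and> gelfand_transform a \<phi>\<^sub>0 \<noteq> 0))"


(* The iterate f^n for an integer n; meaningful for bijective f. *)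
definition int_iterate :: "('b \<Rightarrow> 'b) \<Rightarrow> int \<Rightarrow> 'b \<Rightarrow> 'b" where
  "int_iterate f n = (if 0 \<le> n then f ^^ nat n else inv f ^^ nat (- n))"

(* Defined on all functions from 'a to complex.  For an automorphism \<sigma> it is a bijection there and
   maps character_space onto itself, so its integer iterates restrict to those on characters. *)
definition induced_map :: "('a \<Rightarrow> 'a) \<Rightarrow> ('a \<Rightarrow> complex) \<Rightarrow> ('a \<Rightarrow> complex)" where
  "induced_map \<sigma> \<mu> = \<mu> \<circ> inv \<sigma>"

lemma bij_induced_map:
  assumes "bij \<sigma>"
  shows "bij (induced_map \<sigma>)" and "inv (induced_map \<sigma>) \<mu> = \<mu> \<circ> \<sigma>"
proof -
  have 1: "induced_map \<sigma> (\<nu> \<circ> \<sigma>) = \<nu>" and 2: "induced_map \<sigma> \<nu> \<circ> \<sigma> = \<nu>" for \<nu>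
    using assms by (auto simp: induced_map_def fun_eq_iff bij_is_inj bij_is_surj surj_f_inv_f)
  show b: "bij (induced_map \<sigma>)"
    by (rule o_bij[of "\<lambda>\<nu>. \<nu> \<circ> \<sigma>"]) (auto simp: fun_eq_iff 1[unfolded fun_eq_iff] 2[unfolded fun_eq_iff, simplified])
  show "inv (induced_map \<sigma>) \<mu> = \<mu> \<circ> \<sigma>"
    using inv_f_f[OF bij_is_inj[OF b], of "\<mu> \<circ> \<sigma>"] by (simp add: 1)
qed

lemma induced_map_character_space:
  assumes "complex_algebra_automorphism \<sigma>"
  shows "induced_map \<sigma> ` character_space = character_space"
proof -
  have b: "bij \<sigma>" and h: "complex_algebra_hom \<sigma>"
    using assms by (auto simp: complex_algebra_automorphism_def)
  have s: "\<sigma> (inv \<sigma> x) = x" "inv \<sigma> (\<sigma> x) = x" for x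
    using b by (auto simp: bij_is_inj bij_is_surj surj_f_inv_f)
  have hi: "complex_algebra_hom (inv \<sigma>)"
    using h unfolding complex_algebra_hom_def by (metis s)
  have comp: "\<mu> \<circ> \<tau> \<in> character_space"
    if "\<mu> \<in> character_space" "complex_algebra_hom \<tau>" "surj \<tau>"
    for \<mu> :: "'a \<Rightarrow> complex" and \<tau> :: "'a \<Rightarrow> 'a"
    using that unfolding character_space_def complex_algebra_hom_def
    by simp (metis surjD)
  show ?thesis
  proof
    show "induced_map \<sigma> ` character_space \<subseteq> character_space"
      using comp[OF _ hi] b by (auto simp: induced_map_def bij_imp_bij_inv bij_is_surj)
    show "character_space \<subseteq> induced_map \<sigma> ` character_space"
    proof
      fix \<mu> :: "'a \<Rightarrow> complex" assume "\<mu> \<in> character_space"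
      then have "\<mu> \<circ> \<sigma> \<in> character_space" using comp[OF _ h] b by (simp add: bij_is_surj)
      moreover have "\<mu> = induced_map \<sigma> (\<mu> \<circ> \<sigma>)" by (auto simp: induced_map_def s)
      ultimately show "\<mu> \<in> induced_map \<sigma> ` character_space" by blast
    qed
  qed
qed

definition non_periodic_points ::
    "('a::comm_complex_banach_algebra \<Rightarrow> 'a) \<Rightarrow> ('a \<Rightarrow> complex) set" where
  "non_periodic_points \<sigma> =
     {\<mu> \<in> character_space. \<forall>n. n \<noteq> 0 \<longrightarrow> int_iterate (induced_map \<sigma>) n \<mu> \<noteq> \<mu>}"


(* The underlying set of the crossed product; it does not depend on the automorphism. *)
definition crossed_product :: "(int \<Rightarrow> 'a::comm_complex_banach_algebra) set" where
  "crossed_product = {f. finite {n. f n \<noteq> 0}}"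

(* The sum over all integers k, restricted to the (finite) support of f. *)
definition twisted_conv ::
    "('a \<Rightarrow> 'a) \<Rightarrow> (int \<Rightarrow> 'a) \<Rightarrow> (int \<Rightarrow> 'a::comm_complex_banach_algebra) \<Rightarrow> int \<Rightarrow> 'a" where
  "twisted_conv \<sigma> f g n = (\<Sum>k | f k \<noteq> 0. f k * int_iterate \<sigma> k (g (n - k)))"

(* Two-sided ideals of a complex algebra: as there may be no unit, closure under complex scalars
   is required explicitly. *)
definition crossed_product_ideal ::
    "('a \<Rightarrow> 'a) \<Rightarrow> (int \<Rightarrow> 'a::comm_complex_banach_algebra) set \<Rightarrow> bool" where
  "crossed_product_ideal \<sigma> I \<longleftrightarrow>
     I \<subseteq> crossed_product \<and>
     (\<lambda>_. 0) \<in> I \<and>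
     (\<forall>f\<in>I. \<forall>g\<in>I. (\<lambda>n. f n + g n) \<in> I) \<and>
     (\<forall>c. \<forall>f\<in>I. (\<lambda>n. scaleC c (f n)) \<in> I) \<and>
     (\<forall>f\<in>I. \<forall>g\<in>crossed_product. twisted_conv \<sigma> g f \<in> I \<and> twisted_conv \<sigma> f g \<in> I)"

definition coefficient_algebra :: "(int \<Rightarrow> 'a::comm_complex_banach_algebra) set" where
  "coefficient_algebra = {\<lambda>n. if n = 0 then a else 0 | a. True}"

end

theory Submission
  imports Defs
begin

text \<open>
  Write \<open>\<Delta>\<close> for the character space, \<open>\<delta>\<close> for the generator of the integers in the crossed product,
  and \<open>s\<^sub>n\<close> for the \<open>n\<close>-th iterate of \<open>\<sigma>\<close>.  A character \<open>\<mu>\<close> is non-periodic exactly when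
  \<open>\<mu> \<circ> s\<^sub>n \<noteq> \<mu>\<close> for all \<open>n \<noteq> 0\<close>.

  Suppose the non-periodic points are dense, and let \<open>I\<close> be a non-zero ideal.  Semi-simplicity
  excludes elements of square zero, so multiplication by a monomial yields some \<open>f\<close> in \<open>I\<close> with
  \<open>f\<^sub>0 \<noteq> 0\<close>, and there is a non-periodic \<open>\<mu>\<close> with \<open>\<mu> f\<^sub>0 \<noteq> 0\<close>.  The coefficients of \<open>a f a\<close>, for \<open>a\<close> in
  the algebra, are \<open>f\<^sub>n a (s\<^sub>n a)\<close>.  As \<open>\<mu>\<close> is moved by each of the finitely many non-zero exponents of
  \<open>f\<close>, regularity provides an \<open>a\<close> that does not vanish at \<open>\<mu>\<close> and whose support is so small that
  it is disjoint from its translates, that is \<open>a (s\<^sub>n a) = 0\<close> (\<open>separating_element_finite\<close>).  Then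
  \<open>a f a\<close> is the non-zero element \<open>f\<^sub>0 a\<^sup>2\<close> of the algebra.

  For the converse, let \<open>J\<^sub>n\<close> be the annihilator of all elements \<open>s\<^sub>n b - b\<close> (\<open>fixing_ideal\<close>).  If \<open>u\<close>
  has coefficients in \<open>J\<^sub>n\<close>, then \<open>u \<delta>\<^sup>n\<close> behaves under multiplication like \<open>u\<close> shifted by a central
  unit, so the elements \<open>u (1 - \<delta>\<^sup>n)\<close> form an ideal.  A finitely supported sequence cannot differ
  from its shift at the index \<open>0\<close> alone, hence this ideal meets the algebra only in \<open>0\<close>
  (\<open>difference_ideal_Int_coefficient_algebra\<close>).  So if every non-zero ideal meets the
  algebra non-trivially, then \<open>J\<^sub>n = 0\<close> for all \<open>n \<noteq> 0\<close>.  On the other hand, an element supported in an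
  open set of characters fixed by \<open>s\<^sub>n\<close> belongs to \<open>J\<^sub>n\<close>; by regularity the set of characters moved
  by \<open>s\<^sub>n\<close> is therefore dense (\<open>dense_moved_points\<close>).  It is also open, and the non-periodic points are
  the intersection of these countably many sets.  The Baire category theorem applies since
  \<open>\<Delta>\<close> is locally compact and Hausdorff.
\<close>

section \<open>Homomorphisms and integer iterates\<close>

lemma complex_algebra_homD:
  assumes "complex_algebra_hom h"
  shows "h (x + y) = h x + h y" "h (scaleC c x) = scaleC c (h x)" "h (x * y) = h x * h y"
    "h 0 = 0" "h (- x) = - h x" "h (x - y) = h x - h y"
proof -
  show add: "h (x + y) = h x + h y" for x y
    using assms by (simp add: complex_algebra_hom_def)
  then interpret additive h by unfold_locales
  show "h (scaleC c x) = scaleC c (h x)" "h (x * y) = h x * h y"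
    using assms by (auto simp: complex_algebra_hom_def)
  show "h 0 = 0" "h (- x) = - h x" "h (x - y) = h x - h y"
    by (rule zero minus diff)+
qed

lemma complex_algebra_hom_compose:
  "complex_algebra_hom g \<Longrightarrow> complex_algebra_hom h \<Longrightarrow> complex_algebra_hom (\<lambda>x. g (h x))"
  by (auto simp: complex_algebra_hom_def)

lemma complex_algebra_hom_funpow:
  fixes h :: "'a::comm_complex_banach_algebra \<Rightarrow> 'a"
  assumes "complex_algebra_hom h"
  shows "complex_algebra_hom (h ^^ k)"
proof (induction k)
  case 0
  show ?case by (simp add: complex_algebra_hom_def)
next
  case (Suc k)
  show ?case
    using complex_algebra_hom_compose[OF assms Suc] by (simp add: o_def)
qed

lemma complex_algebra_hom_inv:
  assumes "complex_algebra_automorphism \<sigma>"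
  shows "complex_algebra_hom (inv \<sigma>)"
proof -
  have b: "bij \<sigma>" and h: "complex_algebra_hom \<sigma>"
    using assms by (auto simp: complex_algebra_automorphism_def)
  have "\<sigma> (inv \<sigma> x) = x" "inv \<sigma> (\<sigma> x) = x" for x
    using b by (auto simp: bij_is_inj bij_is_surj surj_f_inv_f)
  then show ?thesis
    using h unfolding complex_algebra_hom_def by metis
qed

lemma complex_algebra_hom_int_iterate:
  assumes "complex_algebra_automorphism \<sigma>"
  shows "complex_algebra_hom (int_iterate \<sigma> n)"
  using assms complex_algebra_hom_inv[OF assms]
  by (auto simp: int_iterate_def complex_algebra_automorphism_def intro: complex_algebra_hom_funpow)

lemma int_iterate_0 [simp]: "int_iterate f 0 x = x"
  by (simp add: int_iterate_def)

lemma int_iterate_succ: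
  assumes "bij f"
  shows "int_iterate f (n + 1) x = f (int_iterate f n x)"
proof (cases "0 \<le> n")
  case True
  then show ?thesis by (simp add: int_iterate_def nat_add_distrib)
next
  case False
  define m where "m = nat (- n) - 1"
  have m: "n = - int (Suc m)" using False by (simp add: m_def)
  have "f (inv f y) = y" for y using assms by (simp add: bij_is_surj surj_f_inv_f)
  then show ?thesis by (cases "m = 0") (simp_all add: int_iterate_def m nat_add_distrib)
qed

lemma int_iterate_add:
  assumes "bij f"
  shows "int_iterate f (m + n) x = int_iterate f m (int_iterate f n x)"
proof (induction m rule: int_induct[where k = 0])
  case base
  show ?case by simp
next
  case (step1 m)
  then show ?case
    using int_iterate_succ[OF assms, of "m + n"] int_iterate_succ[OF assms, of m]
    by (simp add: algebra_simps)
next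
  case (step2 m)
  have "f (int_iterate f (m - 1 + n) x) = f (int_iterate f (m - 1) (int_iterate f n x))"
    using step2 int_iterate_succ[OF assms, of "m - 1 + n"] int_iterate_succ[OF assms, of "m - 1"]
    by (simp add: algebra_simps)
  then show ?case using assms by (simp add: bij_is_inj inj_eq)
qed

lemma int_iterate_induced_map:
  assumes "bij \<sigma>"
  shows "int_iterate (induced_map \<sigma>) n \<mu> = (\<lambda>x. \<mu> (int_iterate \<sigma> (- n) x))"
proof (cases "0 \<le> n")
  case True
  have "(induced_map \<sigma> ^^ k) \<mu> = (\<lambda>x. \<mu> ((inv \<sigma> ^^ k) x))" for k
    by (induction k) (auto simp: induced_map_def fun_eq_iff funpow_swap1)
  with True show ?thesis by (auto simp: int_iterate_def)
next
  case False
  have "(inv (induced_map \<sigma>) ^^ k) \<mu> = (\<lambda>x. \<mu> ((\<sigma> ^^ k) x))" for k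
    by (induction k) (auto simp: bij_induced_map(2)[OF assms] fun_eq_iff funpow_swap1)
  with False show ?thesis by (auto simp: int_iterate_def)
qed

lemma non_periodic_points_iff:
  assumes "bij \<sigma>"
  shows "\<mu> \<in> non_periodic_points \<sigma> \<longleftrightarrow>
    \<mu> \<in> character_space \<and> (\<forall>n. n \<noteq> 0 \<longrightarrow> (\<exists>x. \<mu> (int_iterate \<sigma> n x) \<noteq> \<mu> x))"
  unfolding non_periodic_points_def int_iterate_induced_map[OF assms] fun_eq_iff
  by simp (metis add.inverse_inverse neg_equal_0_iff_equal)

section \<open>The Gelfand topology\<close>

text \<open>
  Characters are automatically continuous.  If \<open>\<bar>\<mu> x\<bar> > \<parallel>x\<parallel>\<close>, rescale \<open>x\<close> to \<open>y\<close> with \<open>\<mu> y = 1\<close> and \<open>\<parallel>y\<parallel> < 1\<close>.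
  The map sending \<open>z\<close> to \<open>y + y z\<close> is then a contraction; its fixed point is the sum of the powers
  \<open>y\<^sup>k\<close> with \<open>k \<ge> 1\<close>, and applying \<open>\<mu>\<close> to the fixed point equation gives \<open>1 = 0\<close>.
\<close>
lemma norm_character_le:
  assumes "complex_algebra_hom (\<mu> :: 'a::comm_complex_banach_algebra \<Rightarrow> complex)"
  shows "cmod (\<mu> x) \<le> norm x"
proof (rule ccontr)
  assume less: "\<not> cmod (\<mu> x) \<le> norm x"
  then have nz: "\<mu> x \<noteq> 0" using norm_ge_zero[of x] by auto
  define y where "y = scaleC (1 / \<mu> x) x"
  have y1: "\<mu> y = 1"
    using nz by (simp add: y_def complex_algebra_homD[OF assms] scaleC_complex_def)
  have y2: "norm y < 1"
    using less nz by (simp add: y_def norm_scaleC norm_divide field_simps)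
  have "\<exists>!z. y + y * z = z"
  proof (rule banach_fix_type[OF norm_ge_zero y2], intro allI)
    fix z w
    have "(y + y * z) - (y + y * w) = y * (z - w)" by (simp add: algebra_simps)
    then show "dist (y + y * z) (y + y * w) \<le> norm y * dist z w"
      unfolding dist_norm using norm_mult_ineq by metis
  qed
  then obtain z where "y + y * z = z" by blast
  then have "\<mu> y + \<mu> y * \<mu> z = \<mu> z"
    using complex_algebra_homD(1,3)[OF assms] by metis
  then show False using y1 by simp
qed

lemma continuous_map_gelfand_eval: "continuous_map gelfand_topology euclidean (\<lambda>\<mu>. \<mu> a)"
  by (rule continuous_map_eq[OF continuous_map_gelfand_transform[of a]])
    (simp add: topspace_gelfand_topology gelfand_transform_def)

text \<open>
  The weakest topology making all evaluations continuous is that of pointwise convergence, so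
  \<open>\<Delta>\<close> can be studied inside a product of complex planes.
\<close>
lemma gelfand_topology_eq_pointwise:
  "gelfand_topology = subtopology (product_topology (\<lambda>_. euclidean) UNIV) character_space"
proof (rule topology_eq[THEN iffD2], intro allI iffI)
  let ?P = "product_topology (\<lambda>_::'a. euclidean :: complex topology) UNIV"
  fix V :: "('a \<Rightarrow> complex) set"
  show "openin (subtopology ?P character_space) V" if "openin gelfand_topology V"
  proof (rule gelfand_topology_weakest[OF _ _ that])
    show "topspace (subtopology ?P character_space) = character_space" by simp
    have "continuous_map (subtopology ?P character_space) euclidean (\<lambda>\<mu>. \<mu> a)" for a
      by (intro continuous_map_from_subtopology continuous_map_product_projection) simp
    then show "continuous_map (subtopology ?P character_space) euclidean (gelfand_transform a)" for a
      by (rule continuous_map_eq) (simp add: gelfand_transform_def)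
  qed
  show "openin gelfand_topology V" if V: "openin (subtopology ?P character_space) V"
  proof -
    obtain W where W: "openin ?P W" "V = W \<inter> character_space"
      using V by (auto simp: openin_subtopology)
    have "continuous_map gelfand_topology ?P (\<lambda>\<mu>. \<mu>)"
      by (simp add: continuous_map_componentwise_UNIV continuous_map_gelfand_eval)
    from openin_continuous_map_preimage[OF this W(1)] show ?thesis
      by (simp add: W(2) topspace_gelfand_topology Int_def conj_commute)
  qed
qed

text \<open>
  The Banach-Alaoglu argument: the homomorphisms, the zero map included, form a closed subset
  of the product of the discs of radius \<open>\<parallel>x\<parallel>\<close>, which is compact by Tychonoff's theorem.
\<close>
lemma compactin_complex_algebra_homs:
  "compactin (product_topology (\<lambda>_. euclidean) UNIV)
     {\<mu> :: 'a::comm_complex_banach_algebra \<Rightarrow> complex. complex_algebra_hom \<mu>}"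
proof (rule closed_compactin)
  let ?K = "PiE UNIV (\<lambda>x::'a. cball (0::complex) (norm x))"
  show "compactin (product_topology (\<lambda>_. euclidean) UNIV) ?K"
    by (simp add: compactin_PiE)
  show "{\<mu>. complex_algebra_hom \<mu>} \<subseteq> ?K"
    using norm_character_le by auto
  have "closed {\<mu> :: 'a \<Rightarrow> complex. complex_algebra_hom \<mu>}"
    unfolding complex_algebra_hom_def scaleC_complex_def
    by (intro closed_Collect_conj closed_Collect_all closed_Collect_eq continuous_intros
        continuous_on_product_coordinates)
  then show "closedin (product_topology (\<lambda>_. euclidean) UNIV)
      {\<mu> :: 'a \<Rightarrow> complex. complex_algebra_hom \<mu>}"
    by (simp add: euclidean_product_topology)
qed

lemma Hausdorff_space_gelfand_topology: "Hausdorff_space gelfand_topology"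
  unfolding gelfand_topology_eq_pointwise
  by (intro Hausdorff_space_subtopology) (simp add: Hausdorff_space_product_topology)

text \<open>
  The characters are the compact space of all homomorphisms with the point \<open>0\<close> removed.  Without a
  unit in the algebra this point may be a limit of characters, and then \<open>\<Delta>\<close> is not compact.
\<close>
lemma locally_compact_space_gelfand_topology:
  "locally_compact_space
     (gelfand_topology :: ('a::comm_complex_banach_algebra \<Rightarrow> complex) topology)"
proof -
  let ?P = "product_topology (\<lambda>_::'a. euclidean :: complex topology) UNIV"
  let ?H = "{\<mu> :: 'a \<Rightarrow> complex. complex_algebra_hom \<mu>}"
  have "Hausdorff_space (subtopology ?P ?H)"
    by (intro Hausdorff_space_subtopology) (simp add: Hausdorff_space_product_topology)
  moreover have "locally_compact_space (subtopology ?P ?H)"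
    using compactin_complex_algebra_homs
    by (intro compact_imp_locally_compact_space) (simp add: compactin_subspace)
  moreover have "openin (subtopology ?P ?H) character_space"
  proof -
    have "open {\<mu> :: 'a \<Rightarrow> complex. \<exists>x. \<mu> x \<noteq> 0}"
      by (intro open_Collect_ex open_Collect_neq continuous_intros
          continuous_on_product_coordinates)
    moreover have "character_space = {\<mu> :: 'a \<Rightarrow> complex. \<exists>x. \<mu> x \<noteq> 0} \<inter> ?H"
      by (auto simp: character_space_def)
    ultimately show ?thesis
      by (auto simp: euclidean_product_topology openin_subtopology)
  qed
  ultimately have "locally_compact_space (subtopology (subtopology ?P ?H) character_space)"
    using locally_compact_space_open_subset by blast
  moreover have "?H \<inter> character_space = character_space"
    by (auto simp: character_space_def)
  ultimately show ?thesis
    by (simp add: gelfand_topology_eq_pointwise subtopology_subtopology)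
qed

lemma Baire_gelfand_topology:
  assumes "countable \<G>"
    and "\<And>T. T \<in> \<G> \<Longrightarrow> openin gelfand_topology T \<and> gelfand_topology closure_of T = character_space"
  shows "gelfand_topology closure_of \<Inter>\<G> = character_space"
  using Baire_category[of gelfand_topology \<G>] assms
  by (simp add: topspace_gelfand_topology locally_compact_space_gelfand_topology
      locally_compact_Hausdorff_imp_regular_space Hausdorff_space_gelfand_topology)

lemma semisimple_algebra_eq_0:
  fixes x :: "'a::comm_complex_banach_algebra"
  assumes "semisimple_algebra TYPE('a)" and "\<And>\<mu>. \<mu> \<in> character_space \<Longrightarrow> \<mu> x = 0"
  shows "x = 0"
proof -
  have "\<mu> 0 = 0" if "\<mu> \<in> character_space" for \<mu> :: "'a \<Rightarrow> complex"
    using that by (simp add: character_space_def complex_algebra_homD)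
  then have "gelfand_transform x = gelfand_transform 0"
    unfolding gelfand_transform_def by (intro restrict_ext) (simp add: assms(2))
  then show ?thesis using assms(1) by (auto simp: semisimple_algebra_def dest: injD)
qed

lemma regular_algebra_supported_element:
  fixes \<mu> :: "'a::comm_complex_banach_algebra \<Rightarrow> complex"
  assumes "regular_algebra TYPE('a)"
    and "openin gelfand_topology U" and "\<mu> \<in> U"
  obtains a :: 'a where "\<mu> a \<noteq> 0" and "\<And>\<phi>. \<phi> \<in> character_space \<Longrightarrow> \<phi> \<notin> U \<Longrightarrow> \<phi> a = 0"
proof -
  have U: "U \<subseteq> character_space"
    using openin_subset[OF assms(2)] by (simp add: topspace_gelfand_topology)
  have "closedin gelfand_topology (character_space - U)"
    using assms(2) by (metis closedin_diff closedin_topspace topspace_gelfand_topology)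
  moreover have "\<mu> \<in> character_space - (character_space - U)"
    using assms(3) U by blast
  ultimately obtain a :: 'a where
    "\<forall>\<phi>\<in>character_space - U. gelfand_transform a \<phi> = 0" "gelfand_transform a \<mu> \<noteq> 0"
    using assms(1) unfolding regular_algebra_def by blast
  then show thesis
    using that assms(3) U by (auto simp: gelfand_transform_def)
qed

section \<open>Ideals in the crossed product\<close>

lemma scaleC_0: "scaleC c 0 = 0"
  using scaleC_add_right[of c 0 0] by simp

lemma scaleC_diff: "scaleC c (x - y) = scaleC c x - scaleC c y"
  using scaleC_add_right[of c "x - y" y] by (simp add: eq_diff_eq)

lemma crossed_product_ideal_twisted_conv:
  assumes "crossed_product_ideal \<sigma> I" and "f \<in> I" and "g \<in> crossed_product"
  shows "twisted_conv \<sigma> g f \<in> I" and "twisted_conv \<sigma> f g \<in> I"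
  using assms by (simp_all add: crossed_product_ideal_def)

lemma twisted_conv_eq_sum:
  assumes "finite F" and "\<And>k. f k \<noteq> 0 \<Longrightarrow> k \<in> F"
  shows "twisted_conv \<sigma> f g n = (\<Sum>k\<in>F. f k * int_iterate \<sigma> k (g (n - k)))"
  unfolding twisted_conv_def using assms by (intro sum.mono_neutral_left) auto

lemma twisted_conv_in_crossed_product:
  assumes "complex_algebra_automorphism \<sigma>" and "f \<in> crossed_product" and "g \<in> crossed_product"
  shows "twisted_conv \<sigma> f g \<in> crossed_product"
proof -
  let ?S = "(\<lambda>(k, l). k + l) ` ({k. f k \<noteq> 0} \<times> {l. g l \<noteq> 0})"
  have "n \<in> ?S" if nz: "twisted_conv \<sigma> f g n \<noteq> 0" for n
  proof -
    obtain k where "f k \<noteq> 0" "f k * int_iterate \<sigma> k (g (n - k)) \<noteq> 0"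
      using nz unfolding twisted_conv_def by (auto elim: sum.not_neutral_contains_not_neutral)
    then have "f k \<noteq> 0" "g (n - k) \<noteq> 0"
      using complex_algebra_homD(4)[OF complex_algebra_hom_int_iterate[OF assms(1)]] by auto
    then show ?thesis by (auto intro!: image_eqI[of _ _ "(k, n - k)"])
  qed
  then have "{n. twisted_conv \<sigma> f g n \<noteq> 0} \<subseteq> ?S" by blast
  moreover have "finite ?S" using assms(2,3) by (auto simp: crossed_product_def)
  ultimately show ?thesis using finite_subset by (auto simp: crossed_product_def)
qed

text \<open>
  The annihilator of all elements \<open>\<tau> b - b\<close>.  In a semi-simple algebra and for an automorphism \<open>\<tau>\<close> it
  consists of the elements that vanish at every character \<open>\<mu>\<close> with \<open>\<mu> \<circ> \<tau> \<noteq> \<mu>\<close>; this algebraic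
  description keeps the ideal computations below free of characters.
\<close>
definition fixing_ideal :: "('a \<Rightarrow> 'a) \<Rightarrow> 'a::comm_complex_banach_algebra set" where
  "fixing_ideal \<tau> = {c. \<forall>b. c * \<tau> b = c * b}"

lemma fixing_ideal_closed:
  shows fixing_ideal_0: "0 \<in> fixing_ideal \<tau>"
    and fixing_ideal_add: "c \<in> fixing_ideal \<tau> \<Longrightarrow> d \<in> fixing_ideal \<tau> \<Longrightarrow> c + d \<in> fixing_ideal \<tau>"
    and fixing_ideal_scaleC: "c \<in> fixing_ideal \<tau> \<Longrightarrow> scaleC r c \<in> fixing_ideal \<tau>"
    and fixing_ideal_mult: "c \<in> fixing_ideal \<tau> \<Longrightarrow> a * c \<in> fixing_ideal \<tau>"
  by (auto simp: fixing_ideal_def distrib_right mult_scaleC_left mult.assoc)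

lemma fixing_ideal_sum:
  "(\<And>x. x \<in> A \<Longrightarrow> f x \<in> fixing_ideal \<tau>) \<Longrightarrow> sum f A \<in> fixing_ideal \<tau>"
  by (induction A rule: infinite_finite_induct) (auto intro: fixing_ideal_closed)

lemma fixing_ideal_int_iterate:
  assumes "complex_algebra_automorphism \<sigma>" and "c \<in> fixing_ideal (int_iterate \<sigma> n)"
  shows "int_iterate \<sigma> k c \<in> fixing_ideal (int_iterate \<sigma> n)"
proof -
  let ?s = "int_iterate \<sigma>"
  have b: "bij \<sigma>" using assms(1) by (simp add: complex_algebra_automorphism_def)
  note add = int_iterate_add[OF b, symmetric]
  note mult = complex_algebra_homD(3)[OF complex_algebra_hom_int_iterate[OF assms(1)]]
  have "?s k c * ?s n x = ?s k c * x" for x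
  proof -
    have "?s k c * ?s n x = ?s k (c * ?s n (?s (- k) x))" by (simp add: mult add)
    also have "\<dots> = ?s k (c * ?s (- k) x)" using assms(2) by (simp add: fixing_ideal_def)
    also have "\<dots> = ?s k c * x" by (simp add: mult add)
    finally show ?thesis .
  qed
  then show ?thesis by (simp add: fixing_ideal_def)
qed

text \<open>
  The elements \<open>u (1 - \<delta>\<^sup>n)\<close> with all coefficients of \<open>u\<close> in the fixing ideal of the \<open>n\<close>-th iterate.
  The formula makes sense although the algebra, and hence the crossed product, may have no unit.
\<close>
definition difference_ideal ::
    "('a \<Rightarrow> 'a) \<Rightarrow> int \<Rightarrow> (int \<Rightarrow> 'a::comm_complex_banach_algebra) set" where
  "difference_ideal \<sigma> n =
     {\<lambda>m. u m - u (m - n) | u. u \<in> crossed_product \<and> (\<forall>m. u m \<in> fixing_ideal (int_iterate \<sigma> n))}"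

text \<open>
  For \<open>f = u (1 - \<delta>\<^sup>n)\<close> one has \<open>g f = (g u) (1 - \<delta>\<^sup>n)\<close> by associativity.  The product in the other
  order is \<open>f g = (u g) (1 - \<delta>\<^sup>n)\<close>: moving \<open>\<delta>\<^sup>n\<close> past \<open>g\<close> applies the \<open>n\<close>-th iterate of \<open>\<sigma>\<close> to the
  coefficients of \<open>g\<close>, and the coefficients of \<open>u\<close> absorb this change.
\<close>
lemma crossed_product_ideal_difference_ideal:
  fixes \<sigma> :: "'a::comm_complex_banach_algebra \<Rightarrow> 'a"
  assumes \<sigma>: "complex_algebra_automorphism \<sigma>"
  shows "crossed_product_ideal \<sigma> (difference_ideal \<sigma> n)"
proof -
  let ?s = "int_iterate \<sigma>" and ?J = "fixing_ideal (int_iterate \<sigma> n)"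
  have b: "bij \<sigma>" using \<sigma> by (simp add: complex_algebra_automorphism_def)
  note hom = complex_algebra_homD[OF complex_algebra_hom_int_iterate[OF \<sigma>]]
  have intro: "h \<in> difference_ideal \<sigma> n"
    if "u \<in> crossed_product" "\<And>m. u m \<in> ?J" "\<And>m. h m = u m - u (m - n)" for h u
    using that unfolding difference_ideal_def by blast
  have supp: "finite {m. u m \<noteq> 0 \<or> u (m - n) \<noteq> 0}" if "u \<in> crossed_product" for u :: "int \<Rightarrow> 'a"
  proof (rule finite_subset)
    show "{m. u m \<noteq> 0 \<or> u (m - n) \<noteq> 0} \<subseteq> {m. u m \<noteq> 0} \<union> (\<lambda>m. m + n) ` {m. u m \<noteq> 0}"
      by (auto intro!: image_eqI[of _ _ "x - n" for x])
  qed (use that in \<open>simp add: crossed_product_def\<close>)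
  have sub: "difference_ideal \<sigma> n \<subseteq> crossed_product"
  proof
    fix h assume "h \<in> difference_ideal \<sigma> n"
    then obtain u where "u \<in> crossed_product" "h = (\<lambda>m. u m - u (m - n))"
      by (auto simp: difference_ideal_def)
    then have "{m. h m \<noteq> 0} \<subseteq> {m. u m \<noteq> 0 \<or> u (m - n) \<noteq> 0}" "u \<in> crossed_product" by auto
    then show "h \<in> crossed_product"
      using finite_subset[OF _ supp[of u]] unfolding crossed_product_def by blast
  qed
  have zero: "(\<lambda>_. 0) \<in> difference_ideal \<sigma> n"
    by (rule intro[of "\<lambda>_. 0"]) (simp_all add: crossed_product_def fixing_ideal_0)
  have add: "(\<lambda>m. f m + g m) \<in> difference_ideal \<sigma> n"
    if fg: "f \<in> difference_ideal \<sigma> n" "g \<in> difference_ideal \<sigma> n" for f g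
  proof -
    obtain u v where u: "u \<in> crossed_product" "\<And>m. u m \<in> ?J" "f = (\<lambda>m. u m - u (m - n))"
      and v: "v \<in> crossed_product" "\<And>m. v m \<in> ?J" "g = (\<lambda>m. v m - v (m - n))"
      using fg unfolding difference_ideal_def by blast
    have "finite ({m. u m \<noteq> 0} \<union> {m. v m \<noteq> 0})"
      using u(1) v(1) by (simp add: crossed_product_def)
    then have "finite {m. u m + v m \<noteq> 0}"
      by (rule rev_finite_subset) auto
    then have "(\<lambda>m. u m + v m) \<in> crossed_product" by (simp add: crossed_product_def)
    then show ?thesis
      by (rule intro) (simp_all add: u v fixing_ideal_add)
  qed
  have scale: "(\<lambda>m. scaleC c (f m)) \<in> difference_ideal \<sigma> n"
    if f: "f \<in> difference_ideal \<sigma> n" for c f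
  proof -
    obtain u where u: "u \<in> crossed_product" "\<And>m. u m \<in> ?J" "f = (\<lambda>m. u m - u (m - n))"
      using f unfolding difference_ideal_def by blast
    have "finite {m. u m \<noteq> 0}" using u(1) by (simp add: crossed_product_def)
    then have "(\<lambda>m. scaleC c (u m)) \<in> crossed_product"
      unfolding crossed_product_def
      by (auto elim!: rev_finite_subset simp: scaleC_0)
    then show ?thesis
      by (rule intro) (simp_all add: u fixing_ideal_scaleC scaleC_diff)
  qed
  have left: "twisted_conv \<sigma> g f \<in> difference_ideal \<sigma> n"
    if f: "f \<in> difference_ideal \<sigma> n" and g: "g \<in> crossed_product" for f g
  proof -
    obtain u where u: "u \<in> crossed_product" "\<And>m. u m \<in> ?J" "f = (\<lambda>m. u m - u (m - n))"
      using f unfolding difference_ideal_def by blast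
    show ?thesis
    proof (rule intro)
      show "twisted_conv \<sigma> g u \<in> crossed_product"
        by (rule twisted_conv_in_crossed_product[OF \<sigma> g u(1)])
      show "twisted_conv \<sigma> g u m \<in> ?J" for m
        unfolding twisted_conv_def
        by (intro fixing_ideal_sum fixing_ideal_mult fixing_ideal_int_iterate \<sigma> u)
      show "twisted_conv \<sigma> g f m = twisted_conv \<sigma> g u m - twisted_conv \<sigma> g u (m - n)" for m
        by (simp add: twisted_conv_def u(3) hom sum_subtractf algebra_simps)
    qed
  qed
  have right: "twisted_conv \<sigma> f g \<in> difference_ideal \<sigma> n"
    if f: "f \<in> difference_ideal \<sigma> n" and g: "g \<in> crossed_product" for f g
  proof -
    obtain u where u: "u \<in> crossed_product" "\<And>m. u m \<in> ?J" "f = (\<lambda>m. u m - u (m - n))"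
      using f unfolding difference_ideal_def by blast
    show ?thesis
    proof (rule intro)
      show "twisted_conv \<sigma> u g \<in> crossed_product"
        by (rule twisted_conv_in_crossed_product[OF \<sigma> u(1) g])
      show "twisted_conv \<sigma> u g m \<in> ?J" for m
        unfolding twisted_conv_def
        by (intro fixing_ideal_sum) (simp add: mult.commute[of "u _"] fixing_ideal_mult u)
      show "twisted_conv \<sigma> f g m = twisted_conv \<sigma> u g m - twisted_conv \<sigma> u g (m - n)" for m
      proof -
        let ?F = "{m. u m \<noteq> 0 \<or> u (m - n) \<noteq> 0}"
        \<comment> \<open>a coefficient of \<open>u\<close> does not see the twist by the \<open>n\<close>-th iterate\<close>
        have absorb: "u k * ?s (k + n) x = u k * ?s k x" for k x
          using u(2)[of k] int_iterate_add[OF b, of n k]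
          by (simp add: fixing_ideal_def add.commute)
        have "(\<Sum>k\<in>?F. u (k - n) * ?s k (g (m - k)))
            = (\<Sum>k | u (k - n) \<noteq> 0. u (k - n) * ?s k (g (m - k)))"
          using supp[OF u(1)] by (intro sum.mono_neutral_right) auto
        also have "\<dots> = (\<Sum>k | u k \<noteq> 0. u k * ?s (k + n) (g (m - n - k)))"
          by (rule sum.reindex_bij_witness[of _ "\<lambda>k. k + n" "\<lambda>k. k - n"])
            (auto simp: algebra_simps)
        also have "\<dots> = twisted_conv \<sigma> u g (m - n)"
          by (simp add: absorb twisted_conv_def)
        finally have shift:
          "(\<Sum>k\<in>?F. u (k - n) * ?s k (g (m - k))) = twisted_conv \<sigma> u g (m - n)" .
        have "twisted_conv \<sigma> f g m = (\<Sum>k\<in>?F. f k * ?s k (g (m - k)))"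
          by (rule twisted_conv_eq_sum[OF supp[OF u(1)]]) (auto simp: u(3))
        also have "\<dots> = (\<Sum>k\<in>?F. u k * ?s k (g (m - k))) - (\<Sum>k\<in>?F. u (k - n) * ?s k (g (m - k)))"
          by (simp add: u(3) left_diff_distrib sum_subtractf)
        also have "(\<Sum>k\<in>?F. u k * ?s k (g (m - k))) = twisted_conv \<sigma> u g m"
          by (rule twisted_conv_eq_sum[OF supp[OF u(1)], symmetric]) auto
        finally show ?thesis by (simp only: shift)
      qed
    qed
  qed
  show ?thesis
    unfolding crossed_product_ideal_def by (intro conjI allI ballI sub zero add scale left right)
qed

text \<open>A value repeated along an infinite arithmetic progression would give infinite support.\<close>
lemma finite_support_periodic_ray:
  fixes u :: "int \<Rightarrow> 'a::zero"
  assumes "finite {m. u m \<noteq> 0}" and "n \<noteq> 0"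
    and step: "\<And>q::nat. u (m + (int q + 1) * n) = u (m + int q * n)"
  shows "u m = 0"
proof (rule ccontr)
  assume "u m \<noteq> 0"
  have "u (m + int q * n) = u m" for q
    by (induction q) (use step in \<open>auto simp: algebra_simps\<close>)
  then have "range (\<lambda>q. m + int q * n) \<subseteq> {m. u m \<noteq> 0}" using \<open>u m \<noteq> 0\<close> by auto
  moreover have "inj (\<lambda>q. m + int q * n)" using \<open>n \<noteq> 0\<close> by (auto intro: injI)
  ultimately show False
    using assms(1) finite_imageD[of "\<lambda>q. m + int q * n" UNIV] finite_subset by auto
qed

text \<open>
  If \<open>u m - u (m - n)\<close> vanishes for all \<open>m \<noteq> 0\<close>, then \<open>u\<close> is constant on \<open>0, n, 2n, \<dots>\<close> and on
  \<open>-n, -2n, \<dots>\<close>.  Finite support makes both constants \<open>0\<close>, so the difference \<open>u 0 - u (-n)\<close> vanishes too.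
\<close>
lemma difference_ideal_Int_coefficient_algebra:
  assumes "complex_algebra_automorphism \<sigma>" and "n \<noteq> 0"
  shows "difference_ideal \<sigma> n \<inter> coefficient_algebra = {\<lambda>_. 0}"
proof
  show "{\<lambda>_. 0} \<subseteq> difference_ideal \<sigma> n \<inter> coefficient_algebra"
    using crossed_product_ideal_difference_ideal[OF assms(1), of n]
    by (auto simp: crossed_product_ideal_def coefficient_algebra_def intro!: exI[of _ 0])
  show "difference_ideal \<sigma> n \<inter> coefficient_algebra \<subseteq> {\<lambda>_. 0}"
  proof
    fix h assume h: "h \<in> difference_ideal \<sigma> n \<inter> coefficient_algebra"
    obtain u where u: "u \<in> crossed_product" "h = (\<lambda>m. u m - u (m - n))"
      using h by (auto simp: difference_ideal_def)
    have h0: "h m = 0" if "m \<noteq> 0" for m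
      using h that by (auto simp: coefficient_algebra_def)
    have fin: "finite {m. u m \<noteq> 0}" using u(1) by (simp add: crossed_product_def)
    have step: "u m = u (m - n)" if "m \<noteq> 0" for m
      using h0[OF that] by (simp add: u(2))
    have "u 0 = 0"
    proof (rule finite_support_periodic_ray[OF fin assms(2)])
      fix q :: nat
      have "(int q + 1) * n \<noteq> 0" using assms(2) by auto
      from step[OF this] show "u (0 + (int q + 1) * n) = u (0 + int q * n)"
        by (simp add: algebra_simps)
    qed
    moreover have "u (- n) = 0"
    proof (rule finite_support_periodic_ray[OF fin, of "- n"])
      fix q :: nat
      have "- (int q + 1) * n \<noteq> 0" using assms(2) by auto
      note shift = step[OF this]
      have next_index: "- n + (int q + 1) * - n = - (int q + 1) * n - n"
        and index: "- n + int q * - n = - (int q + 1) * n"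
        by (simp_all add: algebra_simps)
      show "u (- n + (int q + 1) * - n) = u (- n + int q * - n)"
        unfolding next_index index by (rule shift[symmetric])
    qed (use assms(2) in simp)
    ultimately have "h 0 = 0" by (simp add: u(2))
    with h0 show "h \<in> {\<lambda>_. 0}" by (metis singletonI ext)
  qed
qed

lemma difference_ideal_nonzero:
  assumes "c \<in> fixing_ideal (int_iterate \<sigma> n)" and "c \<noteq> 0" and "n \<noteq> 0"
  shows "difference_ideal \<sigma> n \<noteq> {\<lambda>_. 0}"
proof -
  let ?u = "\<lambda>m::int. if m = 0 then c else 0"
  have "?u \<in> crossed_product" by (simp add: crossed_product_def)
  moreover have "?u m \<in> fixing_ideal (int_iterate \<sigma> n)" for m
    using assms(1) fixing_ideal_0 by auto
  ultimately have "(\<lambda>m. ?u m - ?u (m - n)) \<in> difference_ideal \<sigma> n"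
    unfolding difference_ideal_def by (intro CollectI exI[of _ ?u]) simp
  moreover have "(\<lambda>m. ?u m - ?u (m - n)) \<noteq> (\<lambda>_. 0)"
    using assms(2,3) by (auto dest: fun_cong[of _ _ 0])
  ultimately show ?thesis by blast
qed

section \<open>Density of the non-periodic points\<close>

text \<open>
  An element \<open>c\<close> supported in an open set \<open>U\<close> of characters fixed by \<open>\<tau>\<close> lies in the fixing ideal:
  at a character \<open>\<phi>\<close>, the product \<open>c (\<tau> x - x)\<close> takes the value \<open>\<phi> c (\<phi> (\<tau> x) - \<phi> x)\<close>, whose second
  factor vanishes if \<open>\<phi>\<close> is in \<open>U\<close> and whose first factor vanishes otherwise.
\<close>
lemma dense_moved_points:
  fixes \<tau> :: "'a::comm_complex_banach_algebra \<Rightarrow> 'a"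
  assumes ss: "semisimple_algebra TYPE('a)" and reg: "regular_algebra TYPE('a)"
    and J: "fixing_ideal \<tau> = {0}"
  shows "gelfand_topology closure_of {\<mu> \<in> character_space. \<exists>x. \<mu> (\<tau> x) \<noteq> \<mu> x} = character_space"
proof -
  let ?D = "{\<mu> \<in> character_space. \<exists>x. \<mu> (\<tau> x) \<noteq> \<mu> x}"
  have "?D \<inter> U \<noteq> {}" if U: "openin gelfand_topology U" "U \<noteq> {}" for U
  proof
    assume disj: "?D \<inter> U = {}"
    obtain \<mu> where "\<mu> \<in> U" using U(2) by blast
    obtain c where c: "\<mu> c \<noteq> 0" "\<And>\<phi>. \<phi> \<in> character_space \<Longrightarrow> \<phi> \<notin> U \<Longrightarrow> \<phi> c = 0"
      using regular_algebra_supported_element[OF reg U(1) \<open>\<mu> \<in> U\<close>] by blast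
    have "c * \<tau> x - c * x = 0" for x
    proof (rule semisimple_algebra_eq_0[OF ss])
      fix \<phi> :: "'a \<Rightarrow> complex" assume \<phi>: "\<phi> \<in> character_space"
      then have "\<phi> (c * \<tau> x - c * x) = \<phi> c * (\<phi> (\<tau> x) - \<phi> x)"
        by (simp add: character_space_def complex_algebra_homD right_diff_distrib)
      also have "\<dots> = 0" using c(2)[OF \<phi>] disj \<phi> by auto
      finally show "\<phi> (c * \<tau> x - c * x) = 0" .
    qed
    then have "c \<in> fixing_ideal \<tau>" by (simp add: fixing_ideal_def)
    then have "c = 0" using J by simp
    moreover have "\<mu> \<in> character_space"
      using openin_subset[OF U(1)] \<open>\<mu> \<in> U\<close> by (auto simp: topspace_gelfand_topology)
    ultimately show False using c(1) by (simp add: character_space_def complex_algebra_homD)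
  qed
  then have "gelfand_topology closure_of ?D = topspace gelfand_topology"
    unfolding dense_intersects_open by blast
  then show ?thesis by (simp add: topspace_gelfand_topology)
qed

lemma openin_moved_points:
  "openin gelfand_topology {\<mu> \<in> character_space. \<exists>x. \<mu> (\<tau> x) \<noteq> \<mu> x}"
proof -
  have "openin gelfand_topology {\<mu> \<in> topspace gelfand_topology. \<mu> (\<tau> x) - \<mu> x \<in> - {0}}" for x
    by (intro openin_continuous_map_preimage[where Y = euclidean] continuous_map_diff
        continuous_map_gelfand_eval) auto
  then have "openin gelfand_topology (\<Union>x. {\<mu> \<in> character_space. \<mu> (\<tau> x) - \<mu> x \<in> - {0}})"
    unfolding topspace_gelfand_topology by blast
  moreover have "(\<Union>x. {\<mu> \<in> character_space. \<mu> (\<tau> x) - \<mu> x \<in> - {0}})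
      = {\<mu> \<in> character_space. \<exists>x. \<mu> (\<tau> x) \<noteq> \<mu> x}"
    by auto
  ultimately show ?thesis by simp
qed

lemma dense_non_periodic_points:
  fixes \<sigma> :: "'a::comm_complex_banach_algebra \<Rightarrow> 'a"
  assumes "semisimple_algebra TYPE('a)" and "regular_algebra TYPE('a)" and "bij \<sigma>"
    and "\<And>n. n \<noteq> 0 \<Longrightarrow> fixing_ideal (int_iterate \<sigma> n) = {0}"
  shows "gelfand_topology closure_of non_periodic_points \<sigma> = character_space"
proof -
  let ?G = "\<lambda>n. {\<mu> \<in> character_space. \<exists>x. \<mu> (int_iterate \<sigma> n x) \<noteq> \<mu> x}"
  have "gelfand_topology closure_of \<Inter>(?G ` (- {0})) = character_space"
  proof (rule Baire_gelfand_topology)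
    fix T assume "T \<in> ?G ` (- {0})"
    then obtain n where "n \<noteq> 0" "T = ?G n" by auto
    then show "openin gelfand_topology T \<and> gelfand_topology closure_of T = character_space"
      using openin_moved_points dense_moved_points[OF assms(1,2) assms(4)] by blast
  qed simp
  moreover have "\<Inter>(?G ` (- {0})) = non_periodic_points \<sigma>"
  proof (intro set_eqI iffI)
    fix \<mu> assume "\<mu> \<in> \<Inter>(?G ` (- {0}))"
    then have *: "\<mu> \<in> ?G n" if "n \<noteq> 0" for n using that by blast
    from *[of 1] have "\<mu> \<in> character_space" by simp
    with * show "\<mu> \<in> non_periodic_points \<sigma>"
      by (auto simp: non_periodic_points_iff[OF assms(3)])
  qed (auto simp: non_periodic_points_iff[OF assms(3)])
  ultimately show ?thesis by simp
qed

section \<open>Ideals meeting the coefficient algebra\<close>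

text \<open>
  Disjoint neighbourhoods \<open>V\<close> and \<open>W\<close> of \<open>\<mu> x\<close> and \<open>\<mu> (\<tau> x)\<close> cut out a neighbourhood \<open>U\<close> of \<open>\<mu>\<close>, given
  by \<open>\<phi> x \<in> V\<close> and \<open>\<phi> (\<tau> x) \<in> W\<close>, that never contains both \<open>\<phi>\<close> and its translate \<open>\<phi> \<circ> \<tau>\<close>.  If \<open>a\<close> is
  supported in \<open>U\<close>, then at each \<open>\<phi>\<close> one of \<open>\<phi> a\<close> and \<open>\<phi> (\<tau> a)\<close> is \<open>0\<close>.
\<close>
lemma separating_element:
  fixes \<tau> :: "'a::comm_complex_banach_algebra \<Rightarrow> 'a"
  assumes ss: "semisimple_algebra TYPE('a)" and reg: "regular_algebra TYPE('a)"
    and \<tau>: "complex_algebra_hom \<tau>"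
    and \<mu>: "\<mu> \<in> character_space" and moved: "\<mu> (\<tau> x) \<noteq> \<mu> x"
  obtains a where "\<mu> a \<noteq> 0" and "a * \<tau> a = 0"
proof -
  obtain V W where VW: "open V" "open W" "\<mu> x \<in> V" "\<mu> (\<tau> x) \<in> W" "V \<inter> W = {}"
    using moved separation_t2[of "\<mu> x" "\<mu> (\<tau> x)"] by auto
  define U where "U = {\<phi> \<in> character_space. \<phi> x \<in> V} \<inter> {\<phi> \<in> character_space. \<phi> (\<tau> x) \<in> W}"
  have "openin gelfand_topology U"
    unfolding U_def topspace_gelfand_topology[symmetric]
    by (intro openin_Int openin_continuous_map_preimage[OF continuous_map_gelfand_eval])
      (use VW in auto)
  moreover have "\<mu> \<in> U" using VW \<mu> by (simp add: U_def)
  ultimately obtain a where a: "\<mu> a \<noteq> 0" "\<And>\<phi>. \<phi> \<in> character_space \<Longrightarrow> \<phi> \<notin> U \<Longrightarrow> \<phi> a = 0"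
    using regular_algebra_supported_element[OF reg] by blast
  have "a * \<tau> a = 0"
  proof (rule semisimple_algebra_eq_0[OF ss], rule ccontr)
    fix \<phi> :: "'a \<Rightarrow> complex" assume \<phi>: "\<phi> \<in> character_space" and "\<phi> (a * \<tau> a) \<noteq> 0"
    then have nz: "\<phi> a \<noteq> 0" "\<phi> (\<tau> a) \<noteq> 0"
      by (auto simp: character_space_def complex_algebra_homD)
    have "(\<lambda>y. \<phi> (\<tau> y)) \<in> character_space"
      using \<phi> nz complex_algebra_hom_compose[OF _ \<tau>] by (auto simp: character_space_def)
    with a(2) nz(2) have "\<phi> (\<tau> x) \<in> V" by (auto simp: U_def)
    moreover have "\<phi> (\<tau> x) \<in> W" using a(2)[OF \<phi>] nz(1) by (auto simp: U_def)
    ultimately show False using VW(5) by blast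
  qed
  with a(1) show thesis by (rule that)
qed

text \<open>
  The conditions for different exponents are met simultaneously by the product of the elements
  that meet them one at a time.
\<close>
lemma separating_element_finite:
  fixes \<sigma> :: "'a::comm_complex_banach_algebra \<Rightarrow> 'a"
  assumes ss: "semisimple_algebra TYPE('a)" and reg: "regular_algebra TYPE('a)"
    and \<sigma>: "complex_algebra_automorphism \<sigma>"
    and \<mu>: "\<mu> \<in> non_periodic_points \<sigma>" and "finite N" and "0 \<notin> N"
  obtains a where "\<mu> a \<noteq> 0" and "\<And>n. n \<in> N \<Longrightarrow> a * int_iterate \<sigma> n a = 0"
proof -
  have b: "bij \<sigma>" using \<sigma> by (simp add: complex_algebra_automorphism_def)
  note hom = complex_algebra_hom_int_iterate[OF \<sigma>]
  have ch: "\<mu> \<in> character_space" and h: "complex_algebra_hom \<mu>"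
    using \<mu> by (auto simp: non_periodic_points_def character_space_def)
  have "\<exists>a. \<mu> a \<noteq> 0 \<and> (\<forall>n\<in>N. a * int_iterate \<sigma> n a = 0)"
    using \<open>finite N\<close> \<open>0 \<notin> N\<close>
  proof (induction N rule: finite_induct)
    case empty
    show ?case using ch by (auto simp: character_space_def)
  next
    case (insert n N)
    then obtain a where a: "\<mu> a \<noteq> 0" "\<forall>k\<in>N. a * int_iterate \<sigma> k a = 0" by auto
    obtain x where "\<mu> (int_iterate \<sigma> n x) \<noteq> \<mu> x"
      using \<mu> insert.prems by (auto simp: non_periodic_points_iff[OF b])
    then obtain c where c: "\<mu> c \<noteq> 0" "c * int_iterate \<sigma> n c = 0"
      using separating_element[OF ss reg hom ch] by blast
    have "a * c * int_iterate \<sigma> k (a * c) = (a * int_iterate \<sigma> k a) * (c * int_iterate \<sigma> k c)" for k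
      by (simp add: complex_algebra_homD(3)[OF hom] mult_ac)
    then have "\<forall>k\<in>insert n N. a * c * int_iterate \<sigma> k (a * c) = 0" using a c by auto
    moreover have "\<mu> (a * c) \<noteq> 0" using a c by (simp add: complex_algebra_homD(3)[OF h])
    ultimately show ?case by blast
  qed
  then show thesis using that by blast
qed

text \<open>The element \<open>a \<delta>\<^sup>m\<close> of the crossed product.\<close>
definition delta_monomial :: "int \<Rightarrow> 'a \<Rightarrow> int \<Rightarrow> 'a::zero" where
  "delta_monomial m a = (\<lambda>n. if n = m then a else 0)"

lemma delta_monomial_in_crossed_product: "delta_monomial m a \<in> crossed_product"
  by (simp add: delta_monomial_def crossed_product_def)

lemma twisted_conv_delta_monomial_left:
  "twisted_conv \<sigma> (delta_monomial 0 a) f n = a * f n"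
  by (subst twisted_conv_eq_sum[where F = "{0}"])
    (auto simp: delta_monomial_def split: if_splits)

lemma twisted_conv_delta_monomial_right:
  assumes "complex_algebra_automorphism \<sigma>" and "f \<in> crossed_product"
  shows "twisted_conv \<sigma> f (delta_monomial m a) n = f (n - m) * int_iterate \<sigma> (n - m) a"
proof -
  note z = complex_algebra_homD(4)[OF complex_algebra_hom_int_iterate[OF assms(1)]]
  let ?F = "insert (n - m) {k. f k \<noteq> 0}"
  have fin: "finite ?F" using assms(2) by (simp add: crossed_product_def)
  have "twisted_conv \<sigma> f (delta_monomial m a) n
      = (\<Sum>k\<in>?F. f k * int_iterate \<sigma> k (delta_monomial m a (n - k)))"
    by (rule twisted_conv_eq_sum[OF fin]) auto
  also have "\<dots> = (\<Sum>k\<in>{n - m}. f k * int_iterate \<sigma> k (delta_monomial m a (n - k)))"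
    using fin by (intro sum.mono_neutral_right) (auto simp: delta_monomial_def z)
  finally show ?thesis by (simp add: delta_monomial_def)
qed

text \<open>
  If the coefficient \<open>b\<close> of \<open>f\<close> at \<open>m\<close> is non-zero, right multiplication by the monomial at \<open>-m\<close> whose
  coefficient is the \<open>(-m)\<close>-th iterate of \<open>\<sigma>\<close> at \<open>b\<close> moves it to the index \<open>0\<close>, where it becomes \<open>b\<^sup>2\<close>.
  Squaring replaces a unit, and \<open>b\<^sup>2 \<noteq> 0\<close> because a semi-simple algebra has no nilpotents.
\<close>
lemma ideal_nonzero_constant_coefficient:
  fixes \<sigma> :: "'a::comm_complex_banach_algebra \<Rightarrow> 'a"
  assumes ss: "semisimple_algebra TYPE('a)" and \<sigma>: "complex_algebra_automorphism \<sigma>"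
    and I: "crossed_product_ideal \<sigma> I" and "I \<noteq> {\<lambda>_. 0}"
  obtains f where "f \<in> I" and "f 0 \<noteq> 0"
proof -
  have b: "bij \<sigma>" using \<sigma> by (simp add: complex_algebra_automorphism_def)
  obtain f where f: "f \<in> I" "f \<noteq> (\<lambda>_. 0)"
    using I \<open>I \<noteq> _\<close> unfolding crossed_product_ideal_def by blast
  then obtain m where m: "f m \<noteq> 0" by auto
  define g where "g = twisted_conv \<sigma> f (delta_monomial (- m) (int_iterate \<sigma> (- m) (f m)))"
  have "f \<in> crossed_product" using f I by (auto simp: crossed_product_ideal_def)
  then have "g 0 = f m * f m"
    by (simp add: g_def twisted_conv_delta_monomial_right[OF \<sigma>] int_iterate_add[OF b, symmetric])
  moreover have "f m * f m \<noteq> 0"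
  proof
    assume sq: "f m * f m = 0"
    have "f m = 0"
    proof (rule semisimple_algebra_eq_0[OF ss])
      fix \<mu> :: "'a \<Rightarrow> complex" assume "\<mu> \<in> character_space"
      then have h: "complex_algebra_hom \<mu>" by (simp add: character_space_def)
      from sq have "\<mu> (f m) * \<mu> (f m) = 0"
        using complex_algebra_homD(3,4)[OF h] by metis
      then show "\<mu> (f m) = 0" by simp
    qed
    with m show False by simp
  qed
  moreover have "g \<in> I"
    unfolding g_def
    by (intro crossed_product_ideal_twisted_conv[OF I] f delta_monomial_in_crossed_product)
  ultimately show thesis using that by simp
qed

text \<open>
  Multiplying by \<open>a\<close> on both sides turns the coefficient of \<open>f\<close> at \<open>n\<close> into its product with
  \<open>a\<close> and the \<open>n\<close>-th iterate of \<open>\<sigma>\<close> at \<open>a\<close>.  A separating element \<open>a\<close> for the non-zero exponents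
  of \<open>f\<close> therefore leaves the coefficient at \<open>0\<close> only.
\<close>
lemma ideal_meets_coefficient_algebra:
  fixes \<sigma> :: "'a::comm_complex_banach_algebra \<Rightarrow> 'a"
  assumes ss: "semisimple_algebra TYPE('a)" and reg: "regular_algebra TYPE('a)"
    and \<sigma>: "complex_algebra_automorphism \<sigma>"
    and dense: "gelfand_topology closure_of non_periodic_points \<sigma> = character_space"
    and I: "crossed_product_ideal \<sigma> I" and nz: "I \<noteq> {\<lambda>_. 0}"
  shows "I \<inter> coefficient_algebra \<noteq> {\<lambda>_. 0}"
proof -
  obtain f where f: "f \<in> I" "f 0 \<noteq> 0"
    using ideal_nonzero_constant_coefficient[OF ss \<sigma> I nz] by blast
  have fc: "f \<in> crossed_product" using f I by (auto simp: crossed_product_ideal_def)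
  have "openin gelfand_topology {\<mu> \<in> topspace gelfand_topology. \<mu> (f 0) \<in> - {0}}"
    by (rule openin_continuous_map_preimage[OF continuous_map_gelfand_eval]) auto
  moreover have "{\<mu> \<in> topspace gelfand_topology. \<mu> (f 0) \<in> - {0}} \<noteq> {}"
    using semisimple_algebra_eq_0[OF ss, of "f 0"] f(2) by (auto simp: topspace_gelfand_topology)
  moreover have "gelfand_topology closure_of non_periodic_points \<sigma> = topspace gelfand_topology"
    using dense by (simp add: topspace_gelfand_topology)
  ultimately obtain \<mu> where \<mu>: "\<mu> \<in> non_periodic_points \<sigma>" "\<mu> (f 0) \<noteq> 0"
    unfolding dense_intersects_open by blast
  have h: "complex_algebra_hom \<mu>"
    using \<mu>(1) by (auto simp: non_periodic_points_def character_space_def)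
  have "finite {k. f k \<noteq> 0 \<and> k \<noteq> 0}" using fc by (simp add: crossed_product_def)
  then obtain a where a: "\<mu> a \<noteq> 0" "\<And>n. n \<in> {k. f k \<noteq> 0 \<and> k \<noteq> 0} \<Longrightarrow> a * int_iterate \<sigma> n a = 0"
    by (rule separating_element_finite[OF ss reg \<sigma> \<mu>(1)]) auto
  let ?a = "delta_monomial 0 a"
  define g where "g = twisted_conv \<sigma> ?a (twisted_conv \<sigma> f ?a)"
  have "g \<in> I"
    unfolding g_def
    by (intro crossed_product_ideal_twisted_conv[OF I] f delta_monomial_in_crossed_product)
  have g: "g n = f n * (a * int_iterate \<sigma> n a)" for n
    by (simp add: g_def twisted_conv_delta_monomial_left
        twisted_conv_delta_monomial_right[OF \<sigma> fc] mult_ac)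
  have "g = (\<lambda>n. if n = 0 then f 0 * (a * a) else 0)"
  proof
    fix n
    show "g n = (if n = 0 then f 0 * (a * a) else 0)"
      using a(2)[of n] by (cases "f n = 0") (auto simp: g)
  qed
  then have "g \<in> coefficient_algebra" by (auto simp: coefficient_algebra_def)
  moreover have "g \<noteq> (\<lambda>_. 0)"
  proof
    assume "g = (\<lambda>_. 0)"
    then have "f 0 * (a * a) = 0" using g[of 0] by simp
    then have "\<mu> (f 0) * (\<mu> a * \<mu> a) = 0"
      using complex_algebra_homD(3,4)[OF h] by metis
    then show False using a(1) \<mu>(2) by simp
  qed
  ultimately show ?thesis using \<open>g \<in> I\<close> by blast
qed

theorem theorem4p4:
  fixes \<sigma> :: "'a::comm_complex_banach_algebra \<Rightarrow> 'a"
  assumes "semisimple_algebra TYPE('a)"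
    and "regular_algebra TYPE('a)"
    and "complex_algebra_automorphism \<sigma>"
  shows "gelfand_topology closure_of non_periodic_points \<sigma> = character_space \<longleftrightarrow>
    (\<forall>I. crossed_product_ideal \<sigma> I \<and> I \<noteq> {\<lambda>_. 0} \<longrightarrow>
       I \<inter> coefficient_algebra \<noteq> {\<lambda>_. 0})"
proof
  assume "gelfand_topology closure_of non_periodic_points \<sigma> = character_space"
  then show "\<forall>I. crossed_product_ideal \<sigma> I \<and> I \<noteq> {\<lambda>_. 0} \<longrightarrow>
      I \<inter> coefficient_algebra \<noteq> {\<lambda>_. 0}"
    using ideal_meets_coefficient_algebra[OF assms] by blast
next
  assume meets: "\<forall>I. crossed_product_ideal \<sigma> I \<and> I \<noteq> {\<lambda>_. 0} \<longrightarrow>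
      I \<inter> coefficient_algebra \<noteq> {\<lambda>_. 0}"
  have "fixing_ideal (int_iterate \<sigma> n) = {0}" if "n \<noteq> 0" for n
  proof -
    have "difference_ideal \<sigma> n = {\<lambda>_. 0}"
      using meets crossed_product_ideal_difference_ideal[OF assms(3)]
        difference_ideal_Int_coefficient_algebra[OF assms(3) that] by blast
    then have "c = 0" if "c \<in> fixing_ideal (int_iterate \<sigma> n)" for c
      using difference_ideal_nonzero[OF that _ \<open>n \<noteq> 0\<close>] by blast
    then show ?thesis using fixing_ideal_0 by blast
  qed
  moreover have "bij \<sigma>" using assms(3) by (simp add: complex_algebra_automorphism_def)
  ultimately show "gelfand_topology closure_of non_periodic_points \<sigma> = character_space"
    by (intro dense_non_periodic_points assms) auto
qed

end
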